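(* Let $p$ be an odd prime. Then every abelian $p$-group of order at most $p^5$ is an $\mathrm{NCI}^{(2)}$-group.
   Context: Let $G$ be a finite group and $\mathrm{Sym}(G)$ the group of all permutations of the set $G$. Let $G_r\leq \mathrm{Sym}(G)$ be the group of all right translations $x\mapsto xg$, $g\in G$, and let $\mathrm{Hol}(G)=N_{\mathrm{Sym}(G)}(G_r)=G_r\rtimes \mathrm{Aut}(G)$. For $K\leq \mathrm{Sym}(G)$, the 2-closure $K^{(2)}$ is the largest subgroup of $\mathrm{Sym}(G)$ having the same orbits on $G\times G$ (under componentwise action) as $K$; $K$ is 2-closed if $K^{(2)}=K$. A subgroup of $\mathrm{Sym}(G)$ is $G$-regular if it is regular on $G$ and isomorphic to $G$. A group $K$ with $G_r\leq K\leq \mathrm{Sym}(G)$ is $G$-transjugate if every $G$-regular subgroup of $K$ is conjugate in $K$ to $G_r$. The group $G$ is an $\mathrm{NCI}^{(2)}$-group if every 2-closed group $K$ with $G_r\leq K\leq \mathrm{Hol}(G)$ is $G$-transjugate. *)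

theory Defs
  imports "HOL-Algebra.Algebra" "HOL-Computational_Algebra.Primes"
begin

text \<open>
  The symmetric group on a set \<open>S\<close> is \<^const>\<open>BijGroup\<close>, whose elements are extensional functions
  composed from right to left.  A permutation group is a set \<open>K\<close> with
  \<open>subgroup K (BijGroup S)\<close>; as a group in its own right it is \<open>perm_group S K\<close>.
\<close>

abbreviation perm_group :: "'a set \<Rightarrow> ('a \<Rightarrow> 'a) set \<Rightarrow> ('a \<Rightarrow> 'a) monoid" where
  "perm_group S K \<equiv> (BijGroup S)\<lparr>carrier := K\<rparr>"

definition right_translations :: "('a, 'b) monoid_scheme \<Rightarrow> ('a \<Rightarrow> 'a) set" where
  "right_translations G = {\<lambda>x\<in>carrier G. x \<otimes>\<^bsub>G\<^esub> g | g. g \<in> carrier G}"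

definition Hol :: "('a, 'b) monoid_scheme \<Rightarrow> ('a \<Rightarrow> 'a) set" where
  "Hol G = normalizer (BijGroup (carrier G)) (right_translations G)"

definition pair_action :: "'a set \<Rightarrow> ('a \<Rightarrow> 'a) \<Rightarrow> 'a \<times> 'a \<Rightarrow> 'a \<times> 'a" where
  "pair_action S f = restrict (map_prod f f) (S \<times> S)"

definition orbits2 :: "'a set \<Rightarrow> ('a \<Rightarrow> 'a) set \<Rightarrow> ('a \<times> 'a) set set" where
  "orbits2 S K = orbits (perm_group S K) (S \<times> S) (pair_action S)"

text \<open>
  Largest with respect to inclusion.  Lemma \<open>two_closure_is_greatest\<close> below shows that for a
  permutation group \<open>K\<close> the greatest element exists, so the description is never vacuous there.
\<close>

definition two_closure :: "'a set \<Rightarrow> ('a \<Rightarrow> 'a) set \<Rightarrow> ('a \<Rightarrow> 'a) set" where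
  "two_closure S K = (GREATEST L. subgroup L (BijGroup S) \<and> orbits2 S L = orbits2 S K)"

definition two_closed :: "'a set \<Rightarrow> ('a \<Rightarrow> 'a) set \<Rightarrow> bool" where
  "two_closed S K \<longleftrightarrow> two_closure S K = K"

definition regular_on :: "'a set \<Rightarrow> ('a \<Rightarrow> 'a) set \<Rightarrow> bool" where
  "regular_on S R \<longleftrightarrow> transitive_action (perm_group S R) S (\<lambda>f. f) \<and>
     (\<forall>x\<in>S. stabilizer (perm_group S R) (\<lambda>f. f) x = {\<one>\<^bsub>BijGroup S\<^esub>})"

definition G_regular :: "('a, 'b) monoid_scheme \<Rightarrow> ('a \<Rightarrow> 'a) set \<Rightarrow> bool" where
  "G_regular G R \<longleftrightarrow> subgroup R (BijGroup (carrier G)) \<and> regular_on (carrier G) R \<and>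
     perm_group (carrier G) R \<cong> G"

definition G_transjugate :: "('a, 'b) monoid_scheme \<Rightarrow> ('a \<Rightarrow> 'a) set \<Rightarrow> bool" where
  "G_transjugate G K \<longleftrightarrow>
     (\<forall>R. G_regular G R \<and> R \<subseteq> K \<longrightarrow>
        (\<exists>k\<in>K. R = k <#\<^bsub>BijGroup (carrier G)\<^esub> right_translations G
                     #>\<^bsub>BijGroup (carrier G)\<^esub> inv\<^bsub>BijGroup (carrier G)\<^esub> k))"

definition NCI2_group :: "('a, 'b) monoid_scheme \<Rightarrow> bool" where
  "NCI2_group G \<longleftrightarrow>
     (\<forall>K. subgroup K (BijGroup (carrier G)) \<and> right_translations G \<subseteq> K \<and> K \<subseteq> Hol G \<and>
        two_closed (carrier G) K \<longrightarrow> G_transjugate G K)"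

subsection \<open>Existence of the 2-closure\<close>

lemma carrier_BijGroup: "carrier (BijGroup S) = Bij S"
  by (simp add: BijGroup_def)

lemma Bij_mem: "f \<in> Bij S \<Longrightarrow> x \<in> S \<Longrightarrow> f x \<in> S"
  using Bij_imp_funcset by blast

lemma pair_action_Bij: "f \<in> Bij S \<Longrightarrow> pair_action S f \<in> Bij (S \<times> S)"
  by (auto simp: Bij_def pair_action_def intro!: bij_betw_map_prod)

lemma group_action_pair: "group_action (BijGroup S) (S \<times> S) (pair_action S)"
proof -
  have "pair_action S (f \<otimes>\<^bsub>BijGroup S\<^esub> g)
      = pair_action S f \<otimes>\<^bsub>BijGroup (S \<times> S)\<^esub> pair_action S g"
    if "f \<in> Bij S" "g \<in> Bij S" for f g
    using that pair_action_Bij[OF that(1)] pair_action_Bij[OF that(2)]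
    by (auto simp: BijGroup_def pair_action_def compose_def fun_eq_iff restrict_def Bij_mem)
  then show ?thesis
    unfolding group_action_def group_hom_def group_hom_axioms_def hom_def
    by (auto simp: group_BijGroup pair_action_Bij carrier_BijGroup)
qed

lemma group_action_pair_sub:
  "subgroup K (BijGroup S) \<Longrightarrow> group_action (perm_group S K) (S \<times> S) (pair_action S)"
  by (rule group_action.induced_action[OF group_action_pair])

definition invariant_perms :: "'a set \<Rightarrow> ('a \<Rightarrow> 'a) set \<Rightarrow> ('a \<Rightarrow> 'a) set" where
  "invariant_perms S K =
     {f \<in> Bij S. \<forall>p\<in>S \<times> S. pair_action S f p \<in> orbit (perm_group S K) (pair_action S) p}"

lemma orbits2_eq_iff_orbit:
  assumes "subgroup K (BijGroup S)" "subgroup L (BijGroup S)"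
  shows "orbits2 S L = orbits2 S K \<longleftrightarrow>
    (\<forall>p\<in>S \<times> S. orbit (perm_group S L) (pair_action S) p = orbit (perm_group S K) (pair_action S) p)"
    (is "?l \<longleftrightarrow> ?r")
proof
  interpret K: group_action "perm_group S K" "S \<times> S" "pair_action S"
    by (rule group_action_pair_sub[OF assms(1)])
  interpret L: group_action "perm_group S L" "S \<times> S" "pair_action S"
    by (rule group_action_pair_sub[OF assms(2)])
  assume l: ?l
  show ?r
  proof
    fix p assume p: "p \<in> S \<times> S"
    let ?A = "orbit (perm_group S L) (pair_action S) p"
    let ?B = "orbit (perm_group S K) (pair_action S) p"
    have "?A \<in> orbits2 S L" using p unfolding orbits2_def orbits_def by blast
    then have "?A \<in> orbits2 S K" using l by simp
    moreover have "?B \<in> orbits2 S K" using p unfolding orbits2_def orbits_def by blast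
    moreover have "p \<in> ?A" "p \<in> ?B" using p K.orbit_refl L.orbit_refl by auto
    ultimately show "?A = ?B"
      unfolding orbits2_def using K.disjoint_union by blast
  qed
next
  assume ?r
  then show ?l unfolding orbits2_def orbits_def by (intro Collect_cong) metis
qed

lemma two_closure_is_greatest:
  assumes K: "subgroup K (BijGroup S)"
  shows "subgroup (invariant_perms S K) (BijGroup S)"
    and "orbits2 S (invariant_perms S K) = orbits2 S K"
    and "\<And>L. subgroup L (BijGroup S) \<Longrightarrow> orbits2 S L = orbits2 S K \<Longrightarrow> L \<subseteq> invariant_perms S K"
    and "two_closure S K = invariant_perms S K"
proof -
  interpret K: group_action "perm_group S K" "S \<times> S" "pair_action S"
    by (rule group_action_pair_sub[OF K])
  interpret B: group_action "BijGroup S" "S \<times> S" "pair_action S"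
    by (rule group_action_pair)
  interpret Bg: group "BijGroup S" by (rule group_BijGroup)
  let ?C = "invariant_perms S K"
  let ?o = "orbit (perm_group S K) (pair_action S)"
  note cB = carrier_BijGroup[of S]
  have KB: "K \<subseteq> Bij S" using subgroup.subset[OF K] cB by simp
  have inC: "f \<in> ?C \<longleftrightarrow> f \<in> Bij S \<and> (\<forall>p\<in>S \<times> S. pair_action S f p \<in> ?o p)" for f
    by (auto simp: invariant_perms_def)
  have KC: "K \<subseteq> ?C" using KB by (auto simp: inC orbit_def)
  show C: "subgroup ?C (BijGroup S)"
  proof (rule Bg.subgroupI)
    show "?C \<subseteq> carrier (BijGroup S)" using cB inC by blast
    show "?C \<noteq> {}" using KC subgroup.one_closed[OF K] by blast
  next
    fix f assume f: "f \<in> ?C"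
    then have fc: "f \<in> carrier (BijGroup S)" using cB inC by blast
    have "pair_action S (inv\<^bsub>BijGroup S\<^esub> f) p \<in> ?o p" if p: "p \<in> S \<times> S" for p
    proof -
      define q where "q = pair_action S (inv\<^bsub>BijGroup S\<^esub> f) p"
      have q: "q \<in> S \<times> S" unfolding q_def
        using B.element_image[OF Bg.inv_closed[OF fc] p] by blast
      have "pair_action S f q = p" unfolding q_def
        using B.orbit_sym_aux[OF Bg.inv_closed[OF fc] p refl] fc by simp
      then have "p \<in> ?o q" using f q inC by metis
      then show ?thesis using K.orbit_sym[OF q p] q_def by blast
    qed
    then show "inv\<^bsub>BijGroup S\<^esub> f \<in> ?C" using inC Bg.inv_closed[OF fc] cB by blast
  next
    fix f g assume f: "f \<in> ?C" and g: "g \<in> ?C"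
    then have fc: "f \<in> carrier (BijGroup S)" and gc: "g \<in> carrier (BijGroup S)"
      using cB inC by blast+
    have "pair_action S (f \<otimes>\<^bsub>BijGroup S\<^esub> g) p \<in> ?o p" if p: "p \<in> S \<times> S" for p
    proof -
      define q where "q = pair_action S g p"
      have q: "q \<in> S \<times> S" unfolding q_def using B.element_image[OF gc p] by blast
      have r: "pair_action S f q \<in> S \<times> S" using B.element_image[OF fc q] by blast
      have "pair_action S f q \<in> ?o q" using f q inC by blast
      moreover have "q \<in> ?o p" using g p inC unfolding q_def by blast
      ultimately have "pair_action S f q \<in> ?o p" using K.orbit_trans[OF p q r] by blast
      then show ?thesis using B.composition_rule[OF p fc gc] q_def by simp
    qed
    then show "f \<otimes>\<^bsub>BijGroup S\<^esub> g \<in> ?C" using inC Bg.m_closed[OF fc gc] cB by blast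
  qed
  have "orbit (perm_group S ?C) (pair_action S) p = ?o p" if "p \<in> S \<times> S" for p
    using that KC inC by (auto simp: orbit_def)
  then show orb: "orbits2 S ?C = orbits2 S K"
    using orbits2_eq_iff_orbit[OF K C] by blast
  show max: "L \<subseteq> ?C" if L: "subgroup L (BijGroup S)" "orbits2 S L = orbits2 S K" for L
  proof
    fix f assume f: "f \<in> L"
    have "pair_action S f p \<in> ?o p" if "p \<in> S \<times> S" for p
    proof -
      have "pair_action S f p \<in> orbit (perm_group S L) (pair_action S) p"
        using f by (auto simp: orbit_def)
      then show ?thesis using orbits2_eq_iff_orbit[OF K L(1)] L(2) that by blast
    qed
    then show "f \<in> ?C" using f subgroup.subset[OF L(1)] cB inC by blast
  qed
  show "two_closure S K = ?C"
    unfolding two_closure_def using C orb max by (intro Greatest_equality) auto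
qed

end

theory Submission
  imports Defs
begin

text \<open>
  The result holds for every finite abelian group \<open>G\<close> of odd order, and \<open>p\<close>-groups for odd \<open>p\<close> are
  of this kind.  Let \<open>K\<close> be a 2-closed group between the translations and the holomorph, and let
  \<open>R\<close> be a \<open>G\<close>-regular subgroup of \<open>K\<close>.  The translations are normal in the holomorph, so \<open>R\<close> can
  only be conjugate to them by being equal to them, and this equality is what has to be shown.

  In additive language, let \<open>t x\<close> be the element of \<open>R\<close> that moves \<open>0\<close> to \<open>x\<close>.  As \<open>t x\<close> is an affine
  map, \<open>t x y = x + y + m x y\<close> with \<open>m\<close> additive in the second argument; as \<open>R\<close> is abelian,
  \<open>t x y = t x (t y 0) = t y (t x 0) = t y x\<close>, so \<open>m\<close> is a symmetric biadditive map
  (lemma \<open>symmetric_affine_imp_bimultiplicative\<close>).  It is the product of the commutative ring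
  attached to an abelian regular subgroup of the holomorph, and \<open>R\<close> consists of translations exactly
  when \<open>m = 0\<close>.

  Consider now \<open>f x = x + m x x\<close>.  The difference \<open>m a a - m b b\<close> equals \<open>m (a + b) (a - b)\<close>, so on each
  pair \<open>(a, b)\<close> the map \<open>f\<close> agrees with \<open>t (a + b)\<close> up to a translation, which is an element of \<open>K\<close>.
  Hence \<open>f\<close> lies in the 2-closure of \<open>K\<close>, that is, in \<open>K\<close> itself, and is therefore affine.  But then
  the quadratic map \<open>m x x\<close> is additive, its polarisation \<open>2 m x y\<close> vanishes, and \<open>m = 0\<close> because the
  order of \<open>G\<close> is odd.
\<close>

lemma BijGroup_mult_apply:
  "f \<in> Bij S \<Longrightarrow> g \<in> Bij S \<Longrightarrow> x \<in> S \<Longrightarrow> (f \<otimes>\<^bsub>BijGroup S\<^esub> g) x = f (g x)"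
  by (simp add: BijGroup_def compose_def)

lemma (in group) square_eq_one_imp_one_if_odd_order:
  assumes "odd (order G)" and x: "x \<in> carrier G" and xx: "x \<otimes> x = \<one>"
  shows "x = \<one>"
proof -
  obtain k where k: "order G = 2 * k + 1"
    using assms(1) by (elim oddE)
  have "x [^] order G = (x [^] (2::nat)) [^] k \<otimes> x"
    using x by (simp add: k nat_pow_pow)
  also have "x [^] (2::nat) = \<one>"
    using x xx by (simp add: numeral_2_eq_2)
  finally show ?thesis
    using x pow_order_eq_1[OF x] by simp
qed

lemma (in group) right_translation_Bij:
  assumes g: "g \<in> carrier G"
  shows "(\<lambda>x\<in>carrier G. x \<otimes> g) \<in> Bij (carrier G)"
proof -
  have "bij_betw (\<lambda>x. x \<otimes> g) (carrier G) (carrier G)"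
    by (rule bij_betw_byWitness[where f' = "\<lambda>x. x \<otimes> inv g"]) (use g in \<open>auto simp: m_assoc\<close>)
  then show ?thesis by (simp add: Bij_def)
qed

text \<open>
  Normalising the translations is the same as being affine; the multiplicative form avoids
  splitting an element of the holomorph into an automorphism and a translation.
\<close>

lemma (in group) Hol_affine:
  assumes f: "f \<in> Hol G" and x: "x \<in> carrier G" and y: "y \<in> carrier G"
  shows "f (x \<otimes> y) = f x \<otimes> inv (f \<one>) \<otimes> f y"
proof -
  interpret B: group "BijGroup (carrier G)" by (rule group_BijGroup)
  let ?\<rho> = "\<lambda>z\<in>carrier G. z \<otimes> y"
  have sub: "right_translations G \<subseteq> carrier (BijGroup (carrier G))"
    using right_translation_Bij by (auto simp: right_translations_def carrier_BijGroup)
  have fB: "f \<in> Bij (carrier G)"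
    using f by (simp add: Hol_def normalizer_def stabilizer_def carrier_BijGroup)
  have \<rho>B: "?\<rho> \<in> Bij (carrier G)" using y by (rule right_translation_Bij)
  have "?\<rho> \<in> right_translations G" using y by (auto simp: right_translations_def)
  then have "f \<otimes>\<^bsub>BijGroup (carrier G)\<^esub> ?\<rho> \<otimes>\<^bsub>BijGroup (carrier G)\<^esub> inv\<^bsub>BijGroup (carrier G)\<^esub> f
      \<in> f <#\<^bsub>BijGroup (carrier G)\<^esub> right_translations G #>\<^bsub>BijGroup (carrier G)\<^esub> inv\<^bsub>BijGroup (carrier G)\<^esub> f"
    by (auto simp: l_coset_def r_coset_def)
  then have "f \<otimes>\<^bsub>BijGroup (carrier G)\<^esub> ?\<rho> \<otimes>\<^bsub>BijGroup (carrier G)\<^esub> inv\<^bsub>BijGroup (carrier G)\<^esub> f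
      \<in> right_translations G"
    using f sub by (simp add: Hol_def normalizer_def stabilizer_def)
  then obtain g where g: "g \<in> carrier G"
    and eq: "f \<otimes>\<^bsub>BijGroup (carrier G)\<^esub> ?\<rho> \<otimes>\<^bsub>BijGroup (carrier G)\<^esub> inv\<^bsub>BijGroup (carrier G)\<^esub> f
      = (\<lambda>z\<in>carrier G. z \<otimes> g)"
    by (auto simp: right_translations_def)
  have gB: "(\<lambda>z\<in>carrier G. z \<otimes> g) \<in> Bij (carrier G)" using g by (rule right_translation_Bij)
  have eq': "f \<otimes>\<^bsub>BijGroup (carrier G)\<^esub> ?\<rho> = (\<lambda>z\<in>carrier G. z \<otimes> g) \<otimes>\<^bsub>BijGroup (carrier G)\<^esub> f"
    using B.inv_solve_right[of "\<lambda>z\<in>carrier G. z \<otimes> g" "f \<otimes>\<^bsub>BijGroup (carrier G)\<^esub> ?\<rho>" f]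
      eq fB \<rho>B gB B.m_closed by (simp add: carrier_BijGroup B.inv_solve_right')
  have fz: "f (z \<otimes> y) = f z \<otimes> g" if z: "z \<in> carrier G" for z
    using fun_cong[OF eq', of z] fB \<rho>B gB z Bij_mem[OF fB z]
    by (simp add: BijGroup_mult_apply)
  show ?thesis
    using fz[OF x] fz[OF one_closed] Bij_mem[OF fB x] Bij_mem[OF fB one_closed] g y
    by (simp add: inv_solve_left' m_assoc[symmetric]) (simp add: m_assoc)
qed

text \<open>
  Symmetry makes \<open>t\<close> affine in both arguments.  The witness is the deviation of \<open>t\<close> from the group
  operation; \<open>x\<close> is the constant term \<open>t x \<one>\<close> in the intended use, which is why \<open>inv x\<close> appears in
  the affinity condition.
\<close>

lemma (in comm_group) symmetric_affine_imp_bimultiplicative: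
  assumes closed: "\<And>x y. x \<in> carrier G \<Longrightarrow> y \<in> carrier G \<Longrightarrow> t x y \<in> carrier G"
    and sym: "\<And>x y. x \<in> carrier G \<Longrightarrow> y \<in> carrier G \<Longrightarrow> t x y = t y x"
    and affine: "\<And>x y z. x \<in> carrier G \<Longrightarrow> y \<in> carrier G \<Longrightarrow> z \<in> carrier G \<Longrightarrow>
      t x (y \<otimes> z) = t x y \<otimes> inv x \<otimes> t x z"
  obtains m where "\<And>x y. x \<in> carrier G \<Longrightarrow> y \<in> carrier G \<Longrightarrow> m x y \<in> carrier G"
    and "\<And>x y. x \<in> carrier G \<Longrightarrow> y \<in> carrier G \<Longrightarrow> t x y = x \<otimes> y \<otimes> m x y"
    and "\<And>x y. x \<in> carrier G \<Longrightarrow> y \<in> carrier G \<Longrightarrow> m x y = m y x"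
    and "\<And>x y z. x \<in> carrier G \<Longrightarrow> y \<in> carrier G \<Longrightarrow> z \<in> carrier G \<Longrightarrow>
      m x (y \<otimes> z) = m x y \<otimes> m x z"
proof (rule that[of "\<lambda>x y. inv (x \<otimes> y) \<otimes> t x y"])
  fix x y assume xy: "x \<in> carrier G" "y \<in> carrier G"
  show "inv (x \<otimes> y) \<otimes> t x y \<in> carrier G" using xy closed by simp
  show "t x y = x \<otimes> y \<otimes> (inv (x \<otimes> y) \<otimes> t x y)"
    using xy closed by (simp add: m_assoc[symmetric])
  show "inv (x \<otimes> y) \<otimes> t x y = inv (y \<otimes> x) \<otimes> t y x"
    using xy by (simp add: sym[of x y] m_comm[of x y])
next
  fix x y z assume "x \<in> carrier G" "y \<in> carrier G" "z \<in> carrier G"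
  then show "inv (x \<otimes> (y \<otimes> z)) \<otimes> t x (y \<otimes> z)
      = inv (x \<otimes> y) \<otimes> t x y \<otimes> (inv (x \<otimes> z) \<otimes> t x z)"
    using closed by (simp add: affine inv_mult m_ac)
qed

text \<open>
  A 2-closed group contains every permutation that it interpolates on pairs of points; this is the
  only property of 2-closed groups that the argument uses.
\<close>

lemma two_closed_memI:
  assumes K: "subgroup K (BijGroup S)" "two_closed S K" and f: "f \<in> Bij S"
    and pairs: "\<And>a b. a \<in> S \<Longrightarrow> b \<in> S \<Longrightarrow> \<exists>k\<in>K. k a = f a \<and> k b = f b"
  shows "f \<in> K"
proof -
  have "pair_action S f (a, b) \<in> orbit (perm_group S K) (pair_action S) (a, b)"
    if ab: "a \<in> S" "b \<in> S" for a b
  proof -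
    obtain k where "k \<in> K" "k a = f a" "k b = f b" using pairs[OF ab] by blast
    then have "pair_action S f (a, b) = pair_action S k (a, b)" "k \<in> K"
      using ab by (auto simp: pair_action_def)
    then show ?thesis by (auto simp: orbit_def)
  qed
  then have "f \<in> invariant_perms S K"
    using f by (auto simp: invariant_perms_def)
  then show ?thesis
    using K two_closure_is_greatest(4)[OF K(1)] by (simp add: two_closed_def)
qed

text \<open>
  Here the quadratic map \<open>f\<close> of the introduction is shown to lie in \<open>K\<close> and then to be affine, which
  kills \<open>m\<close>.  Only transitivity of \<open>R\<close> is assumed, since a transitive abelian permutation group is
  automatically regular.
\<close>

lemma (in comm_group) transitive_abelian_subgroup_eq_right_translations:
  assumes fin: "finite (carrier G)" and odd: "odd (order G)"
    and K: "subgroup K (BijGroup (carrier G))" and GK: "right_translations G \<subseteq> K"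
    and KH: "K \<subseteq> Hol G" and closed: "two_closed (carrier G) K" and RK: "R \<subseteq> K"
    and trans: "\<And>x y. x \<in> carrier G \<Longrightarrow> y \<in> carrier G \<Longrightarrow> \<exists>r\<in>R. r x = y"
    and abel: "\<And>r s x. r \<in> R \<Longrightarrow> s \<in> R \<Longrightarrow> x \<in> carrier G \<Longrightarrow> r (s x) = s (r x)"
  shows "R = right_translations G"
proof -
  have KB: "K \<subseteq> Bij (carrier G)"
    using subgroup.subset[OF K] by (simp add: carrier_BijGroup)
  have "\<forall>x\<in>carrier G. \<exists>r\<in>R. r \<one> = x" using trans by blast
  then obtain t where tR: "\<And>x. x \<in> carrier G \<Longrightarrow> t x \<in> R"
    and t1: "\<And>x. x \<in> carrier G \<Longrightarrow> t x \<one> = x"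
    by metis
  have tB: "t x \<in> Bij (carrier G)" if "x \<in> carrier G" for x
    using tR[OF that] RK KB by blast
  have t_closed: "t x y \<in> carrier G" if "x \<in> carrier G" "y \<in> carrier G" for x y
    using that Bij_mem[OF tB] by blast
  have t_sym: "t x y = t y x" if "x \<in> carrier G" "y \<in> carrier G" for x y
    using abel[OF tR[OF that(1)] tR[OF that(2)] one_closed] that by (simp add: t1)
  have t_affine: "t x (y \<otimes> z) = t x y \<otimes> inv x \<otimes> t x z"
    if "x \<in> carrier G" "y \<in> carrier G" "z \<in> carrier G" for x y z
    using Hol_affine[of "t x" y z] that tR RK KH t1 by auto
  obtain m where m: "\<And>x y. x \<in> carrier G \<Longrightarrow> y \<in> carrier G \<Longrightarrow> m x y \<in> carrier G"
    and t_m: "\<And>x y. x \<in> carrier G \<Longrightarrow> y \<in> carrier G \<Longrightarrow> t x y = x \<otimes> y \<otimes> m x y"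
    and m_sym: "\<And>x y. x \<in> carrier G \<Longrightarrow> y \<in> carrier G \<Longrightarrow> m x y = m y x"
    and m_mult: "\<And>x y z. x \<in> carrier G \<Longrightarrow> y \<in> carrier G \<Longrightarrow> z \<in> carrier G \<Longrightarrow>
      m x (y \<otimes> z) = m x y \<otimes> m x z"
    using symmetric_affine_imp_bimultiplicative[of t, OF t_closed t_sym t_affine] by blast
  have m_mult': "m (x \<otimes> y) z = m x z \<otimes> m y z"
    if "x \<in> carrier G" "y \<in> carrier G" "z \<in> carrier G" for x y z
    using that by (simp add: m_sym[of _ z] m_mult)
  define f where "f = (\<lambda>x\<in>carrier G. x \<otimes> m x x)"
  have f_closed: "f x \<in> carrier G" if "x \<in> carrier G" for x
    using that m by (simp add: f_def)
  (* Additively, t (a + b) a = f a + t a b and t (a + b) b = f b + t a b: the cross term m a b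
     occurs in both values, so the same translation corrects both of them. *)
  have pairs: "\<exists>k\<in>K. k a = f a \<and> k b = f b" if a: "a \<in> carrier G" and b: "b \<in> carrier G" for a b
  proof -
    let ?B = "BijGroup (carrier G)"
    let ?\<rho> = "\<lambda>x\<in>carrier G. x \<otimes> inv (t a b)"
    let ?k = "?\<rho> \<otimes>\<^bsub>?B\<^esub> t (a \<otimes> b)"
    have ab: "a \<otimes> b \<in> carrier G" using a b by simp
    have \<rho>K: "?\<rho> \<in> K"
      using GK inv_closed[OF t_closed[OF a b]] by (fastforce simp: right_translations_def)
    have "?k \<in> K"
      using subgroup.m_closed[OF K \<rho>K] tR[OF ab] RK by blast
    moreover have "?k x = t (a \<otimes> b) x \<otimes> inv (t a b)" if "x \<in> carrier G" for x
      using that \<rho>K KB tB[OF ab] t_closed[OF ab] by (auto simp: BijGroup_mult_apply)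
    moreover have "t (a \<otimes> b) a = f a \<otimes> t a b"
      using a b m by (simp add: t_m f_def m_mult' m_sym[of b a] m_ac)
    moreover have "t (a \<otimes> b) b = f b \<otimes> t a b"
      using a b m by (simp add: t_m f_def m_mult' m_ac)
    ultimately show ?thesis
      using a b f_closed t_closed by (intro bexI[of _ ?k]) (simp_all add: m_assoc)
  qed
  (* Injectivity is inherited from the permutation that agrees with f on the pair in question. *)
  have "inj_on f (carrier G)"
  proof (rule inj_onI)
    fix a b assume ab: "a \<in> carrier G" "b \<in> carrier G" "f a = f b"
    then obtain k where "k \<in> K" "k a = k b" using pairs by metis
    then show "a = b"
      using KB ab by (auto simp: Bij_def bij_betw_def dest: inj_onD)
  qed
  then have "f \<in> Bij (carrier G)"
    using fin f_closed endo_inj_surj[of "carrier G" f]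
    by (auto simp: Bij_def bij_betw_def f_def)
  then have fH: "f \<in> Hol G"
    using two_closed_memI[OF K closed _ pairs] KH by blast
  have m1: "m x y = \<one>" if x: "x \<in> carrier G" and y: "y \<in> carrier G" for x y
  proof (rule square_eq_one_imp_one_if_odd_order[OF odd m[OF x y]])
    have "m \<one> \<one> = \<one>" using m_mult[of \<one> \<one> \<one>] m[of \<one> \<one>] by (simp add: l_cancel_one)
    then have "f (x \<otimes> y) = f x \<otimes> f y"
      using Hol_affine[OF fH x y] x y f_closed by (simp add: f_def)
    moreover have "f (x \<otimes> y) = (f x \<otimes> f y) \<otimes> (m x y \<otimes> m x y)"
      using x y m by (simp add: f_def m_mult m_mult' m_sym[of y x] m_ac)
    ultimately show "m x y \<otimes> m x y = \<one>"
      using x y m f_closed by (simp add: l_cancel_one')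
  qed
  have t_eq: "t x = (\<lambda>y\<in>carrier G. y \<otimes> x)" if x: "x \<in> carrier G" for x
    by (rule extensionalityI[of _ "carrier G"])
      (use x tB[OF x] in \<open>auto simp: Bij_def t_m m1 m_comm\<close>)
  have "r \<in> right_translations G" if r: "r \<in> R" for r
  proof -
    have rB: "r \<in> Bij (carrier G)" using r RK KB by blast
    let ?x = "r \<one>"
    have x: "?x \<in> carrier G" using Bij_mem[OF rB] by simp
    (* Commuting with the transitive family t, the permutation r is determined by its value at the
       identity. *)
    have r_eq: "r y = t ?x y" if y: "y \<in> carrier G" for y
      using abel[OF r tR[OF y] one_closed] t_sym[OF x y] y by (simp add: t1)
    have "r = t ?x"
      by (rule extensionalityI[OF Bij_imp_extensional[OF rB] Bij_imp_extensional[OF tB[OF x]] r_eq])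
    then show ?thesis using t_eq[OF x] x by (auto simp: right_translations_def)
  qed
  moreover have "right_translations G \<subseteq> R"
    using tR t_eq by (fastforce simp: right_translations_def)
  ultimately show ?thesis by blast
qed

theorem NCI2_group_if_abelian_odd_order:
  assumes "comm_group G" and fin: "finite (carrier G)" and odd: "odd (order G)"
  shows "NCI2_group G"
  unfolding NCI2_group_def G_transjugate_def
proof (intro allI impI, elim conjE)
  interpret comm_group G by fact
  interpret B: group "BijGroup (carrier G)" by (rule group_BijGroup)
  let ?B = "BijGroup (carrier G)"
  fix K R
  assume K: "subgroup K ?B" "right_translations G \<subseteq> K" "K \<subseteq> Hol G" "two_closed (carrier G) K"
    and R: "G_regular G R" "R \<subseteq> K"
  have Rsub: "subgroup R ?B" and reg: "regular_on (carrier G) R"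
    and iso: "perm_group (carrier G) R \<cong> G"
    using R(1) by (auto simp: G_regular_def)
  have RB: "R \<subseteq> Bij (carrier G)"
    using subgroup.subset[OF Rsub] by (simp add: carrier_BijGroup)
  have "group (perm_group (carrier G) R)"
    using B.subgroup_imp_group[OF Rsub] .
  then have "comm_group (perm_group (carrier G) R)"
    using iso_imp_comm_group[OF group.iso_sym[OF _ iso]] group.is_monoid by blast
  then interpret R: comm_group "perm_group (carrier G) R" .
  have abel: "r (s x) = s (r x)" if "r \<in> R" "s \<in> R" "x \<in> carrier G" for r s x
  proof -
    have "r \<otimes>\<^bsub>?B\<^esub> s = s \<otimes>\<^bsub>?B\<^esub> r" using R.m_comm[of r s] that by simp
    then show ?thesis using that RB by (metis BijGroup_mult_apply subsetD)
  qed
  have trans: "\<exists>r\<in>R. r x = y" if "x \<in> carrier G" "y \<in> carrier G" for x y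
    using transitive_action.unique_orbit[of "perm_group (carrier G) R" "carrier G" "\<lambda>f. f"] reg that
    by (auto simp: regular_on_def)
  have "R = right_translations G"
    by (rule transitive_abelian_subgroup_eq_right_translations[OF fin odd K R(2)])
      (fact trans, fact abel)
  moreover have "\<one>\<^bsub>?B\<^esub> <#\<^bsub>?B\<^esub> R #>\<^bsub>?B\<^esub> inv\<^bsub>?B\<^esub> \<one>\<^bsub>?B\<^esub> = R"
    using subgroup.subset[OF Rsub] by (simp add: B.lcos_mult_one)
  ultimately show "\<exists>k\<in>K. R = k <#\<^bsub>?B\<^esub> right_translations G #>\<^bsub>?B\<^esub> inv\<^bsub>?B\<^esub> k"
    using subgroup.one_closed[OF K(1)] by metis
qed

theorem theorem1p5:
  fixes G :: "('a, 'b) monoid_scheme" and p :: nat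
  assumes "Factorial_Ring.prime p" and "odd p"
    and "comm_group G" and "finite (carrier G)"
    and "\<exists>n. Coset.order G = p ^ n"
    and "Coset.order G \<le> p ^ 5"
  shows "NCI2_group G"
proof (rule NCI2_group_if_abelian_odd_order)
  show "odd (Coset.order G)" using assms(2,5) by auto
qed (fact assms)+

end
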